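(* Let $v=(v_1,\ldots,v_n)\in\mathbb{N}^n$. Every $D$-path of join irreducible elements in the multinomial lattice $\mathcal{L}(v)$ has length at most $n-2$. If $v_i>0$ for $i=1,\ldots,n$, then such length is realized, that is, there is a $D$-path of join irreducible elements in $\mathcal{L}(v)$ of length $n-2$.
   Context: $\mathbb{N}$ is the set of non-negative integers, and the dimension $n$ can be an arbitrary positive integer. For $v=(v_1,\ldots,v_n)\in\mathbb{N}^n$, $\mathcal{L}(v)$ is the set of words over the alphabet $\{a_1,\ldots,a_n\}$ in which each letter $a_i$ occurs exactly $v_i$ times. It is ordered by the reflexive and transitive closure of the relation $\rightarrow$, where $w\rightarrow u$ iff $w=w_1a_ia_jw_2$ and $u=w_1a_ja_iw_2$ for some words $w_1,w_2$ and some $i<j$. This ordered set is a lattice. An element $j$ of a finite lattice is join irreducible if it has a unique lower cover, denoted $j_\star$; $m$ is meet irreducible if it has a unique upper cover, denoted $m^\star$. The join dependency relation $D$ between join irreducible elements is: $j\,D\,j'$ iff $j\ne j'$ and there is a meet irreducible $m$ with $j\not\le m$, $j\le m^\star$, $j'\not\le m$ and $j'_\star\le m$. A $D$-path of length $k$ is a sequence $j_0,j_1,\ldots,j_k$ of join irreducible elements with $j_{i}\,D\,j_{i+1}$ for $0\le i<k$ (so the length counts the number of $D$-steps). *)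

theory Defs
  imports Main
begin

section \<open>Join dependency in a finite poset\<close>

text \<open>A poset is given by its reflexive order relation \<open>r\<close>: the carrier is \<open>Field r\<close>
  and \<open>(x, y) \<in> r\<close> reads \<open>x \<le> y\<close>.\<close>

definition covered_by :: "'a rel \<Rightarrow> 'a \<Rightarrow> 'a \<Rightarrow> bool" where
  "covered_by r x y \<longleftrightarrow>
     (x, y) \<in> r \<and> x \<noteq> y \<and> (\<forall>z. (x, z) \<in> r \<longrightarrow> (z, y) \<in> r \<longrightarrow> z = x \<or> z = y)"

definition join_irreducible :: "'a rel \<Rightarrow> 'a \<Rightarrow> bool" where
  "join_irreducible r j \<longleftrightarrow> j \<in> Field r \<and> (\<exists>!x. covered_by r x j)"

definition meet_irreducible :: "'a rel \<Rightarrow> 'a \<Rightarrow> bool" where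
  "meet_irreducible r m \<longleftrightarrow> m \<in> Field r \<and> (\<exists>!x. covered_by r m x)"

definition lower_cover :: "'a rel \<Rightarrow> 'a \<Rightarrow> 'a" where
  "lower_cover r j = (THE x. covered_by r x j)"

definition upper_cover :: "'a rel \<Rightarrow> 'a \<Rightarrow> 'a" where
  "upper_cover r m = (THE x. covered_by r m x)"

definition join_dependency :: "'a rel \<Rightarrow> 'a \<Rightarrow> 'a \<Rightarrow> bool" where
  "join_dependency r j j' \<longleftrightarrow>
     join_irreducible r j \<and> join_irreducible r j' \<and> j \<noteq> j' \<and>
     (\<exists>m. meet_irreducible r m \<and>
          (j, m) \<notin> r \<and> (j, upper_cover r m) \<in> r \<and>
          (j', m) \<notin> r \<and> (lower_cover r j', m) \<in> r)"

text \<open>A path of length \<open>k\<close> is the list of its \<open>k + 1\<close> vertices. The length is an integer, and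
  the empty list is the only path of length \<open>- 1\<close>; every path of length \<open>k \<ge> 0\<close> is a
  non-empty sequence \<open>j\<^sub>0, \<dots>, j\<^sub>k\<close>.\<close>

definition D_path :: "'a rel \<Rightarrow> 'a list \<Rightarrow> bool" where
  "D_path r js \<longleftrightarrow>
     (\<forall>j\<in>set js. join_irreducible r j) \<and> successively (join_dependency r) js"

definition D_path_length :: "'a list \<Rightarrow> int" where
  "D_path_length js = int (length js) - 1"

section \<open>Multinomial lattices\<close>

text \<open>The letter \<open>a\<^sub>i\<close> is the number \<open>i \<in> {1..n}\<close>; only the values of \<open>v\<close> on \<open>{1..n}\<close> matter.\<close>

definition multinomial_words :: "nat \<Rightarrow> (nat \<Rightarrow> nat) \<Rightarrow> nat list set" where
  "multinomial_words n v = {w. set w \<subseteq> {1..n} \<and> (\<forall>i\<in>{1..n}. count_list w i = v i)}"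

definition swap_step :: "nat list rel" where
  "swap_step = {(w1 @ [i, j] @ w2, w1 @ [j, i] @ w2) | w1 w2 i j. i < j}"

definition multinomial_lattice :: "nat \<Rightarrow> (nat \<Rightarrow> nat) \<Rightarrow> nat list rel" where
  "multinomial_lattice n v =
     swap_step\<^sup>* \<inter> (multinomial_words n v \<times> multinomial_words n v)"

lemma Field_multinomial_lattice: "Field (multinomial_lattice n v) = multinomial_words n v"
  by (auto simp: multinomial_lattice_def Field_def)

end

theory Submission
  imports Defs "HOL-Library.Sublist" "HOL-Library.Multiset"
begin

text \<open>
  Number the occurrences of every letter in a word from left to right, starting at \<open>0\<close>. For
  \<open>i < j\<close>, a word inverts occurrence \<open>k\<close> of \<open>i\<close> with occurrence \<open>l\<close> of \<open>j\<close> if the latter comes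
  first. The multinomial order is inclusion of inversion sets (\<open>multinomial_lattice_iff\<close>), and a
  swap adds exactly one inversion, so that the covers are the swaps. A join irreducible word
  therefore has exactly one descent, \<open>w = A B\<close> with \<open>A\<close> and \<open>B\<close> weakly increasing, where the
  last letter \<open>b\<close> of \<open>A\<close> exceeds the first letter \<open>a\<close> of \<open>B\<close>. Dually, a meet irreducible word has
  exactly one ascent \<open>c < d\<close>, and reversing words exchanges the two cases. In both cases the
  inversions can be read off from the multiplicities of the letters before the descent or ascent.

  Suppose that \<open>m\<close>, with ascent \<open>c < d\<close>, witnesses \<open>j D j'\<close>, where \<open>j\<close> has the descent \<open>b > a\<close>
  and \<open>j'\<close> the descent \<open>b' > a'\<close>. The one inversion that the upper cover of \<open>m\<close> adds to \<open>m\<close> is an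
  inversion of \<open>j\<close>; hence \<open>d\<close> occurs before the descent of \<open>j\<close> and \<open>c\<close> after it, which gives
  \<open>a \<le> c\<close> and \<open>d \<le> b\<close>. The one inversion that \<open>j'\<close> adds to its lower cover is not an inversion of
  \<open>m\<close>, which gives \<open>c \<le> a'\<close> and \<open>b' \<le> d\<close>. So the intervals are nested,
  \<open>{a'..b'} \<subseteq> {c..d} \<subseteq> {a..b}\<close>. If they all coincide, then \<open>j\<close> and \<open>j'\<close> lie below the upper cover
  of \<open>m\<close> but not below \<open>m\<close>, and \<open>m\<close> determines the only join irreducible word with
  descent \<open>d > c\<close> and this property (\<open>descent_determined_by_ascent\<close>), so \<open>j = j'\<close>. Hence \<open>b - a\<close> strictly
  decreases along a path (\<open>join_dependency_shrinks\<close>), and it takes values between \<open>n - 1\<close> and \<open>1\<close>.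

  The bound is reached by the words that are sorted except that the last \<open>1\<close> has been moved
  behind the last \<open>b\<close>, for \<open>b = n, n - 1, \<dots>, 2\<close> (\<open>path_word_join_dependency\<close>).
\<close>

section \<open>Inversions\<close>

text \<open>
  A tuple \<open>(i, k, j, l)\<close> says that occurrence \<open>l\<close> of \<open>j\<close> precedes occurrence \<open>k\<close> of \<open>i\<close>, witnessed by
  a prefix that contains the former and not the latter. No bound is put on \<open>k\<close>: an occurrence of
  \<open>i\<close> that does not exist counts as lying behind the end of the word. These extra tuples
  depend only on the multiplicities of the letters, so they do not affect inclusions between words
  with the same letters.
\<close>
definition inversions :: "nat list \<Rightarrow> (nat \<times> nat \<times> nat \<times> nat) set" where
  "inversions w =
     {(i, k, j, l). i < j \<and> (\<exists>q. prefix q w \<and> count_list q i \<le> k \<and> l < count_list q j)}"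

lemma count_list_prefix_le: "prefix q p \<Longrightarrow> count_list q e \<le> count_list p e"
  by (auto elim!: prefixE)

text \<open>
  A prefix of the swapped word that ends outside the swapped pair has a counterpart with the same
  letters in the original word, so only \<open>p @ [j]\<close> can witness a new inversion.
\<close>
lemma inversions_swap_subset:
  assumes "i < j"
  shows "inversions (p @ [j, i] @ s) \<subseteq>
    insert (i, count_list p i, j, count_list p j) (inversions (p @ [i, j] @ s))"
proof (rule subsetI, rule insertCI, unfold split_paired_all)
  fix a k b l
  assume mem: "(a, k, b, l) \<in> inversions (p @ [j, i] @ s)"
    and old: "(a, k, b, l) \<notin> inversions (p @ [i, j] @ s)"
  have no: "l \<ge> count_list q b" if "prefix q (p @ [i, j] @ s)" "count_list q a \<le> k" for q
    using old mem that by (auto simp: inversions_def not_less)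
  from mem obtain q where ab: "a < b" and q: "prefix q (p @ [j, i] @ s)" "count_list q a \<le> k"
    "l < count_list q b"
    by (auto simp: inversions_def)
  have "\<not> prefix q p" using no[of q] q by (auto simp: prefix_append)
  moreover have "q \<noteq> p @ j # i # us" if "prefix us s" for us
    using no[of "p @ i # j # us"] q that by (auto split: if_splits)
  ultimately have qp: "q = p @ [j]"
    using q(1) by (auto simp: prefix_append prefix_Cons)
  have "l \<ge> count_list p b" using no[of p] q qp by (auto split: if_splits)
  then have bj: "b = j" "l = count_list p j" using q qp by (auto split: if_splits)
  then have "\<not> count_list (p @ [i, j]) a \<le> k" using no[of "p @ [i, j]"] assms by auto
  then have "a = i \<and> k = count_list p i"
    using q qp ab bj by (cases "a = i") auto
  then show "(a, k, b, l) = (i, count_list p i, j, count_list p j)"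
    using bj by simp
qed

lemma inversions_swap_mono:
  assumes "i < j"
  shows "inversions (p @ [i, j] @ s) \<subseteq> inversions (p @ [j, i] @ s)"
proof clarify
  fix a k b l
  assume mem: "(a, k, b, l) \<in> inversions (p @ [i, j] @ s)"
  then obtain q where ab: "a < b" and q: "prefix q (p @ [i, j] @ s)" "count_list q a \<le> k"
    "l < count_list q b"
    by (auto simp: inversions_def)
  have I: "(a, k, b, l) \<in> inversions (p @ [j, i] @ s)"
    if "prefix q' (p @ [j, i] @ s)" "count_list q' a \<le> k" "l < count_list q' b" for q'
    using that ab by (auto simp: inversions_def)
  consider "prefix q p" | "q = p @ [i]" | us where "q = p @ i # j # us" "prefix us s"
    using q(1) by (auto simp: prefix_append prefix_Cons)
  then show "(a, k, b, l) \<in> inversions (p @ [j, i] @ s)"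
  proof cases
    case 1
    then show ?thesis using I[of q] q by (auto simp: prefix_append)
  next
    case 2
    then show ?thesis using I[of p] I[of "p @ [j, i]"] q ab assms
      by (cases "b = i") (auto split: if_splits)
  next
    case 3
    then show ?thesis using I[of "p @ j # i # us"] q by (auto split: if_splits)
  qed
qed

lemma inversions_swap:
  assumes "i < j"
  shows "inversions (p @ [j, i] @ s) =
    insert (i, count_list p i, j, count_list p j) (inversions (p @ [i, j] @ s))"
proof -
  have "prefix (p @ [j]) (p @ [j, i] @ s)" by simp
  moreover have "count_list (p @ [j]) i \<le> count_list p i" "count_list p j < count_list (p @ [j]) j"
    using assms by auto
  ultimately have "(i, count_list p i, j, count_list p j) \<in> inversions (p @ [j, i] @ s)"
    using assms unfolding inversions_def by blast
  then show ?thesis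
    using inversions_swap_subset[OF assms] inversions_swap_mono[OF assms] by blast
qed

lemma swapped_pair_not_inverted:
  assumes "i < j"
  shows "(i, count_list p i, j, count_list p j) \<notin> inversions (p @ [i, j] @ s)"
proof
  assume "(i, count_list p i, j, count_list p j) \<in> inversions (p @ [i, j] @ s)"
  then obtain q where q: "prefix q (p @ [i, j] @ s)" "count_list q i \<le> count_list p i"
    "count_list p j < count_list q j"
    by (auto simp: inversions_def)
  then show False
    using count_list_prefix_le[of q p j] by (auto simp: prefix_append prefix_Cons split: if_splits)
qed

lemma inversions_swap_psubset:
  assumes "(w, u) \<in> swap_step"
  shows "inversions w \<subset> inversions u"
  using assms inversions_swap swapped_pair_not_inverted
  by (fastforce simp: swap_step_def)

lemma inversions_rtrancl:
  assumes "(w, u) \<in> swap_step\<^sup>*"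
  shows "inversions w \<subseteq> inversions u"
  using assms by induction (use inversions_swap_psubset in blast)+

lemma swap_step_Cons: "(w, u) \<in> swap_step \<Longrightarrow> (x # w, x # u) \<in> swap_step"
  unfolding swap_step_def by (fastforce intro: exI[of _ "x # _"])

lemma swap_steps_Cons: "(w, u) \<in> swap_step\<^sup>* \<Longrightarrow> (x # w, x # u) \<in> swap_step\<^sup>*"
  by (induction rule: rtrancl_induct) (auto intro: swap_step_Cons rtrancl_into_rtrancl)

lemma swap_steps_to_front:
  assumes "\<forall>x\<in>set q. x < j"
  shows "(q @ j # r, j # q @ r) \<in> swap_step\<^sup>*"
  using assms
proof (induction q)
  case (Cons x q)
  have "(x # j # q @ r, j # x # q @ r) \<in> swap_step"
    unfolding swap_step_def using Cons.prems by (fastforce intro: exI[of _ "[]"])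
  moreover have "(x # q @ j # r, x # j # q @ r) \<in> swap_step\<^sup>*"
    using Cons by (intro swap_steps_Cons) auto
  ultimately show ?case by auto
qed simp

text \<open>
  The converse of \<open>inversions_rtrancl\<close>, by sorting \<open>w\<close> towards \<open>u\<close> from the left. If \<open>u\<close> starts with
  \<open>j\<close>, a letter greater than \<open>j\<close> before the first \<open>j\<close> of \<open>w\<close> would give an inversion that \<open>u\<close> does
  not have; so all letters in front of that \<open>j\<close> are smaller, and upward swaps bring it to the front.
  Deleting the two leading letters keeps the inclusion of inversion sets, with the occurrences of
  \<open>j\<close> renumbered by one.
\<close>
lemma swap_steps_if_inversions_subset:
  assumes "\<forall>e. count_list w e = count_list u e" "inversions w \<subseteq> inversions u"
  shows "(w, u) \<in> swap_step\<^sup>*"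
  using assms
proof (induction u arbitrary: w)
  case Nil
  have "w = []"
  proof (cases w)
    case (Cons x xs)
    then show ?thesis using Nil.prems(1)[rule_format, of x] by simp
  qed simp
  then show ?case by simp
next
  case (Cons j u)
  have "j \<in> set w"
    using Cons.prems(1)[rule_format, of j] by (metis count_list_0_iff count_list.simps(2) Suc_eq_plus1 nat.simps(3))
  then obtain q r where w: "w = q @ j # r" and jq: "j \<notin> set q"
    by (auto dest: split_list_first)
  have less: "x < j" if "x \<in> set q" for x
  proof (rule ccontr)
    assume "\<not> x < j"
    with that jq have jx: "j < x" by (cases "x = j") auto
    have "count_list q x > 0" using that by (metis count_list_0_iff neq0_conv)
    with jx jq have "(j, 0, x, 0) \<in> inversions w"
      by (auto simp: inversions_def w prefix_append intro!: exI[of _ q])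
    then have "(j, 0, x, 0) \<in> inversions (j # u)" using Cons.prems(2) by blast
    then show False
      by (auto simp: inversions_def prefix_Cons)
  qed
  have "inversions (q @ r) \<subseteq> inversions u"
  proof clarify
    fix a k b l
    assume "(a, k, b, l) \<in> inversions (q @ r)"
    then obtain t where ab: "a < b" and t: "prefix t (q @ r)" "count_list t a \<le> k"
      "l < count_list t b"
      by (auto simp: inversions_def)
    \<comment> \<open>Passes from a prefix of \<open>w\<close> through the inclusion to a prefix of the shortened \<open>u\<close>;
      the conditionals account for the leading \<open>j\<close> that has been dropped.\<close>
    have lift: "\<exists>t'. prefix t' u \<and>
        count_list t' a + (if a = j then 1 else 0) \<le> k' \<and> l' < count_list t' b + (if b = j then 1 else 0)"
      if "prefix t' w" "count_list t' a \<le> k'" "l' < count_list t' b" for t' k' l'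
    proof -
      have "(a, k', b, l') \<in> inversions w" using that ab by (auto simp: inversions_def)
      then have "(a, k', b, l') \<in> inversions (j # u)" using Cons.prems(2) by blast
      then obtain t'' where t'': "prefix t'' (j # u)" "count_list t'' a \<le> k'" "l' < count_list t'' b"
        by (auto simp: inversions_def)
      then obtain ys where "t'' = j # ys" "prefix ys u" by (cases t'') auto
      with t'' show ?thesis by (intro exI[of _ ys]) auto
    qed
    show "(a, k, b, l) \<in> inversions u"
    proof (cases "prefix t q")
      case True
      then have bj: "b \<noteq> j" using t(3) jq
        by (metis count_list_0_iff gr_implies_not0 set_mono_prefix subsetD)
      show ?thesis
      proof (cases "a = j")
        case True
        then show ?thesis
          using lift[of t "Suc k" l] \<open>prefix t q\<close> t ab bj by (auto simp: inversions_def w prefix_append)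
      next
        case False
        then show ?thesis
          using lift[of t k l] \<open>prefix t q\<close> t ab bj by (auto simp: inversions_def w prefix_append)
      qed
    next
      case False
      then obtain us where us: "t = q @ us" "prefix us r" using t(1) by (auto simp: prefix_append)
      then have "prefix (q @ j # us) w" by (simp add: w)
      moreover have "count_list (q @ j # us) a = count_list t a + (if a = j then 1 else 0)"
        "count_list (q @ j # us) b = count_list t b + (if b = j then 1 else 0)"
        by (auto simp: us)
      ultimately show ?thesis
        using lift[of "q @ j # us" "k + (if a = j then 1 else 0)" "l + (if b = j then 1 else 0)"] t ab
        by (auto simp: inversions_def split: if_splits)
    qed
  qed
  moreover have "count_list (q @ r) e = count_list u e" for e
    using Cons.prems(1)[rule_format, of e] by (auto simp: w split: if_splits)
  ultimately have "(j # q @ r, j # u) \<in> swap_step\<^sup>*"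
    using Cons.IH by (intro swap_steps_Cons) auto
  then show ?case
    using swap_steps_to_front[of q j r] less w by auto
qed

section \<open>The multinomial order and its covers\<close>

lemma multinomial_words_count_eq:
  assumes "w \<in> multinomial_words n v" "u \<in> multinomial_words n v"
  shows "count_list w e = count_list u e"
proof (cases "e \<in> {1..n}")
  case False
  then have "e \<notin> set w" "e \<notin> set u" using assms by (auto simp: multinomial_words_def)
  then show ?thesis by (simp add: count_notin)
qed (use assms in \<open>auto simp: multinomial_words_def\<close>)

lemma multinomial_lattice_iff:
  assumes "w \<in> multinomial_words n v" "u \<in> multinomial_words n v"
  shows "(w, u) \<in> multinomial_lattice n v \<longleftrightarrow> inversions w \<subseteq> inversions u"
  using assms swap_steps_if_inversions_subset[of w u] multinomial_words_count_eq[OF assms]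
    inversions_rtrancl[of w u]
  by (auto simp: multinomial_lattice_def)

lemma swap_in_multinomial_words:
  "p @ [i, j] @ s \<in> multinomial_words n v \<longleftrightarrow> p @ [j, i] @ s \<in> multinomial_words n v"
  by (auto simp: multinomial_words_def)

text \<open>
  A swap is a cover because it adds a single inversion, while every strict step of the order adds
  at least one.
\<close>
lemma covered_by_multinomial_lattice_iff:
  "covered_by (multinomial_lattice n v) x y \<longleftrightarrow>
     y \<in> multinomial_words n v \<and> (x, y) \<in> swap_step"
proof
  assume c: "covered_by (multinomial_lattice n v) x y"
  then have xy: "(x, y) \<in> swap_step\<^sup>*" "x \<noteq> y" "x \<in> multinomial_words n v"
    "y \<in> multinomial_words n v"
    by (auto simp: covered_by_def multinomial_lattice_def)
  then obtain z where z: "(x, z) \<in> swap_step" "(z, y) \<in> swap_step\<^sup>*"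
    by (auto elim: converse_rtranclE)
  then have "z \<in> multinomial_words n v" "z \<noteq> x"
    using xy(3) inversions_swap_psubset[OF z(1)] swap_in_multinomial_words
    by (auto simp: swap_step_def)
  then have "z = y"
    using c z xy by (auto simp: covered_by_def multinomial_lattice_def)
  then show "y \<in> multinomial_words n v \<and> (x, y) \<in> swap_step" using xy z by simp
next
  assume y: "y \<in> multinomial_words n v \<and> (x, y) \<in> swap_step"
  then obtain p i j s where ij: "i < j" and x: "x = p @ [i, j] @ s" and yp: "y = p @ [j, i] @ s"
    by (auto simp: swap_step_def)
  have xw: "x \<in> multinomial_words n v" using y x yp swap_in_multinomial_words by blast
  have "inversions x \<subset> inversions y" using y inversions_swap_psubset by blast
  moreover have "z = x \<or> z = y"
    if z: "(x, z) \<in> multinomial_lattice n v" "(z, y) \<in> multinomial_lattice n v" for z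
  proof (rule ccontr)
    assume "\<not> ?thesis"
    then have "(x, z) \<in> swap_step\<^sup>+" "(z, y) \<in> swap_step\<^sup>+"
      using z by (auto simp: multinomial_lattice_def rtrancl_eq_or_trancl)
    then obtain x' z' where "(x, x') \<in> swap_step" "(x', z) \<in> swap_step\<^sup>*"
      "(z, z') \<in> swap_step" "(z', y) \<in> swap_step\<^sup>*"
      by (auto dest!: tranclD)
    then have "inversions x \<subset> inversions z" "inversions z \<subset> inversions y"
      using inversions_swap_psubset inversions_rtrancl by blast+
    then show False using inversions_swap[OF ij] by (auto simp: x yp)
  qed
  ultimately show "covered_by (multinomial_lattice n v) x y"
    using y xw by (auto simp: covered_by_def multinomial_lattice_def)
qed

section \<open>Irreducible elements\<close>

text \<open>
  Decompositions of a word around a descent or ascent that is its only one: the word itself is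
  \<open>p @ [b, a] @ s\<close> and \<open>p @ [c, d] @ s\<close>, respectively.
\<close>
definition single_descent :: "nat list \<Rightarrow> nat \<Rightarrow> nat \<Rightarrow> nat list \<Rightarrow> bool" where
  "single_descent p b a s \<longleftrightarrow> a < b \<and> sorted (p @ [b]) \<and> sorted (a # s)"

definition single_ascent :: "nat list \<Rightarrow> nat \<Rightarrow> nat \<Rightarrow> nat list \<Rightarrow> bool" where
  "single_ascent p c d s \<longleftrightarrow> c < d \<and> sorted_wrt (\<ge>) (p @ [c]) \<and> sorted_wrt (\<ge>) (d # s)"

lemma not_sorted_descent:
  fixes xs :: "nat list"
  assumes "\<not> sorted xs"
  obtains p b a s where "xs = p @ [b, a] @ s" "a < b"
proof -
  have "\<exists>p b a s. xs = p @ [b, a] @ s \<and> a < b"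
    using assms
  proof (induction xs rule: induct_list012)
    case (3 x y zs)
    show ?case
    proof (cases "x \<le> y")
      case True
      then have "\<not> sorted (y # zs)" using 3 by (simp only: sorted2) simp
      then obtain p b a s where "y # zs = p @ [b, a] @ s" "a < b" using 3 by blast
      then have "x # y # zs = (x # p) @ [b, a] @ s" by simp
      then show ?thesis using \<open>a < b\<close> by blast
    next
      case False
      then have "x # y # zs = [] @ [x, y] @ zs" "y < x" by auto
      then show ?thesis by blast
    qed
  qed auto
  then show thesis using that by blast
qed

lemma single_descent_unique:
  assumes "single_descent p b a s" "a' < b'" "p @ [b, a] @ s = p' @ [b', a'] @ s'"
  shows "p' = p \<and> b' = b \<and> a' = a \<and> s' = s"
proof -
  have "p' = p"
    using assms(3) unfolding append_eq_append_conv2[of p]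
  proof (elim exE disjE conjE)
    fix us assume us: "p = p' @ us" "us @ [b, a] @ s = [b', a'] @ s'"
    show ?thesis
    proof (cases us)
      case (Cons x xs)
      then show ?thesis
        using us assms(1,2) by (cases xs) (auto simp: single_descent_def sorted_append)
    qed (use us in simp)
  next
    fix us assume us: "p @ us = p'" "[b, a] @ s = us @ [b', a'] @ s'"
    show ?thesis
    proof (cases us)
      case (Cons x xs)
      then have "a # s = xs @ [b', a'] @ s'" using us by simp
      moreover have "sorted (a # s)" using assms(1) by (simp only: single_descent_def)
      ultimately have "sorted (xs @ [b', a'] @ s')" by simp
      then show ?thesis using assms(2) by (simp add: sorted_append)
    qed (use us in simp)
  qed
  then show ?thesis using assms(3) by simp
qed

lemma single_descent_join_irreducible:
  assumes "single_descent p b a s" "p @ [b, a] @ s \<in> multinomial_words n v"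
  shows "join_irreducible (multinomial_lattice n v) (p @ [b, a] @ s)"
    and "lower_cover (multinomial_lattice n v) (p @ [b, a] @ s) = p @ [a, b] @ s"
proof -
  have iff: "covered_by (multinomial_lattice n v) x (p @ [b, a] @ s) \<longleftrightarrow> x = p @ [a, b] @ s" for x
  proof
    assume "covered_by (multinomial_lattice n v) x (p @ [b, a] @ s)"
    then obtain p' b' a' s' where "x = p' @ [a', b'] @ s'" "a' < b'"
      "p @ [b, a] @ s = p' @ [b', a'] @ s'"
      by (auto simp: covered_by_multinomial_lattice_iff swap_step_def)
    then show "x = p @ [a, b] @ s" using single_descent_unique[OF assms(1)] by blast
  next
    assume "x = p @ [a, b] @ s"
    then show "covered_by (multinomial_lattice n v) x (p @ [b, a] @ s)"
      using assms by (auto simp: covered_by_multinomial_lattice_iff swap_step_def single_descent_def)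
  qed
  show "join_irreducible (multinomial_lattice n v) (p @ [b, a] @ s)"
    "lower_cover (multinomial_lattice n v) (p @ [b, a] @ s) = p @ [a, b] @ s"
    using assms(2)
    by (simp_all only: join_irreducible_def lower_cover_def iff Field_multinomial_lattice) auto
qed

text \<open>
  Undoing a descent gives a lower cover, and undoing descents at different positions gives
  different lower covers.
\<close>
lemma join_irreducible_single_descent:
  assumes "join_irreducible (multinomial_lattice n v) y"
  obtains p b a s where "single_descent p b a s" "y = p @ [b, a] @ s"
proof -
  from assms obtain x where yw: "y \<in> multinomial_words n v"
    and x: "covered_by (multinomial_lattice n v) x y"
    and uniq: "\<And>x'. covered_by (multinomial_lattice n v) x' y \<Longrightarrow> x' = x"
    by (auto simp: join_irreducible_def Field_multinomial_lattice)
  then obtain p a b s where ab: "a < b" and xp: "x = p @ [a, b] @ s" and y: "y = p @ [b, a] @ s"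
    by (auto simp: covered_by_multinomial_lattice_iff swap_step_def)
  have uniq': "p' @ [a', b'] @ s' = p @ [a, b] @ s" if "y = p' @ [b', a'] @ s'" "a' < b'" for p' b' a' s'
    using that yw uniq[of "p' @ [a', b'] @ s'"]
    by (auto simp: covered_by_multinomial_lattice_iff swap_step_def xp)
  have "sorted (p @ [b])"
  proof (rule ccontr)
    assume "\<not> sorted (p @ [b])"
    then obtain p' b' a' s' where d: "p @ [b] = p' @ [b', a'] @ s'" "a' < b'"
      by (rule not_sorted_descent)
    have "y = (p @ [b]) @ a # s" using y by simp
    then have "y = p' @ [b', a'] @ (s' @ a # s)" unfolding d(1) by simp
    from uniq'[OF this d(2)] have "(p' @ [a', b'] @ s') @ a # s = (p @ [a]) @ b # s" by simp
    moreover have "length (p' @ [a', b'] @ s') = length (p @ [a])"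
      using arg_cong[OF d(1), of length] by simp
    ultimately show False using ab by simp
  qed
  moreover have "sorted (a # s)"
  proof (rule ccontr)
    assume "\<not> sorted (a # s)"
    then obtain p' b' a' s' where d: "a # s = p' @ [b', a'] @ s'" "a' < b'"
      by (rule not_sorted_descent)
    have "y = (p @ b # p') @ [b', a'] @ s'" using d(1) y by simp
    then have "(p @ b # p') @ [a', b'] @ s' = p @ [a, b] @ s" using uniq' d(2) by blast
    then show False using ab by simp
  qed
  ultimately show thesis using that ab y by (auto simp: single_descent_def)
qed

text \<open>
  Reversing words is an order-reversing bijection of the lattice, so it carries the description of
  the join irreducible words to the meet irreducible ones.
\<close>
lemma rev_in_multinomial_words: "rev w \<in> multinomial_words n v \<longleftrightarrow> w \<in> multinomial_words n v"
  by (simp add: multinomial_words_def)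

lemma rev_swap_step: "(rev x, rev y) \<in> swap_step \<longleftrightarrow> (y, x) \<in> swap_step"
proof -
  have *: "(rev x, rev y) \<in> swap_step" if "(y, x) \<in> swap_step" for x y
  proof -
    from that obtain p i j s where "y = p @ [i, j] @ s" "x = p @ [j, i] @ s" "i < j"
      by (auto simp: swap_step_def)
    then have "rev x = rev s @ [i, j] @ rev p" "rev y = rev s @ [j, i] @ rev p" by auto
    then show ?thesis using \<open>i < j\<close> unfolding swap_step_def by blast
  qed
  show ?thesis using *[of y x] *[of "rev x" "rev y"] by auto
qed

lemma covered_by_rev:
  "covered_by (multinomial_lattice n v) (rev x) (rev y) \<longleftrightarrow> covered_by (multinomial_lattice n v) y x"
proof -
  have "x \<in> multinomial_words n v \<longleftrightarrow> y \<in> multinomial_words n v" if "(y, x) \<in> swap_step"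
    using that swap_in_multinomial_words by (auto simp: swap_step_def)
  then show ?thesis
    by (auto simp: covered_by_multinomial_lattice_iff rev_swap_step rev_in_multinomial_words)
qed

lemma covered_by_rev_left:
  "covered_by (multinomial_lattice n v) x (rev m) \<longleftrightarrow> covered_by (multinomial_lattice n v) m (rev x)"
  using covered_by_rev[of n v "rev x" m] by simp

lemma meet_irreducible_iff_rev:
  "meet_irreducible (multinomial_lattice n v) m \<longleftrightarrow> join_irreducible (multinomial_lattice n v) (rev m)"
proof -
  have "(\<exists>!x. P (rev x)) \<longleftrightarrow> (\<exists>!x. P x)" for P :: "nat list \<Rightarrow> bool"
    by (metis rev_rev_ident)
  from this[of "covered_by (multinomial_lattice n v) m"] show ?thesis
    by (simp add: meet_irreducible_def join_irreducible_def covered_by_rev_left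
        Field_multinomial_lattice rev_in_multinomial_words)
qed

lemma single_descent_rev: "single_descent (rev s) d c (rev p) \<longleftrightarrow> single_ascent p c d s"
proof -
  have "sorted (rev s @ [d]) \<longleftrightarrow> sorted_wrt (\<ge>) (d # s)"
    using sorted_wrt_rev[of "(\<le>)" "d # s"] by simp
  moreover have "sorted (c # rev p) \<longleftrightarrow> sorted_wrt (\<ge>) (p @ [c])"
    using sorted_wrt_rev[of "(\<le>)" "p @ [c]"] by simp
  ultimately show ?thesis unfolding single_descent_def single_ascent_def by blast
qed

lemma single_ascent_meet_irreducible:
  assumes "single_ascent p c d s" "p @ [c, d] @ s \<in> multinomial_words n v"
  shows "meet_irreducible (multinomial_lattice n v) (p @ [c, d] @ s)"
    and "upper_cover (multinomial_lattice n v) (p @ [c, d] @ s) = p @ [d, c] @ s"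
proof -
  have rev: "rev (p @ [c, d] @ s) = rev s @ [d, c] @ rev p" by simp
  have w: "rev s @ [d, c] @ rev p \<in> multinomial_words n v"
    using assms(2) rev_in_multinomial_words[of "p @ [c, d] @ s" n v] unfolding rev by simp
  note j = single_descent_join_irreducible[OF single_descent_rev[THEN iffD2, OF assms(1)] w]
  show m: "meet_irreducible (multinomial_lattice n v) (p @ [c, d] @ s)"
    unfolding meet_irreducible_iff_rev rev by (rule j)
  have "covered_by (multinomial_lattice n v) (p @ [c, d] @ s) (p @ [d, c] @ s)"
    using assms swap_in_multinomial_words
    by (auto simp: covered_by_multinomial_lattice_iff swap_step_def single_ascent_def)
  then show "upper_cover (multinomial_lattice n v) (p @ [c, d] @ s) = p @ [d, c] @ s"
    using m unfolding upper_cover_def meet_irreducible_def by (blast intro: the1_equality)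
qed

lemma meet_irreducible_single_ascent:
  assumes "meet_irreducible (multinomial_lattice n v) m"
  obtains p c d s where "single_ascent p c d s" "m = p @ [c, d] @ s"
proof -
  from assms obtain p d c s where "single_descent p d c s" "rev m = p @ [d, c] @ s"
    unfolding meet_irreducible_iff_rev by (rule join_irreducible_single_descent)
  then have "single_ascent (rev s) c d (rev p)" "m = rev s @ [c, d] @ rev p"
    using single_descent_rev[of "rev p" d c "rev s"] by (auto simp: rev_swap)
  then show thesis by (rule that)
qed

section \<open>Inversions of irreducible elements\<close>

text \<open>
  Inside a weakly increasing block, all occurrences of \<open>i\<close> come before all those of \<open>j\<close>, so an
  inversion needs \<open>j\<close> in \<open>A\<close> and \<open>i\<close> in \<open>B\<close>. The second disjunct comes from nonexistent occurrences
  of \<open>i\<close>.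
\<close>
lemma inversions_increasing:
  assumes "sorted A" "sorted B" "i < j"
  shows "(i, k, j, l) \<in> inversions (A @ B) \<longleftrightarrow>
    l < count_list A j \<and> count_list A i \<le> k \<or>
    l < count_list (A @ B) j \<and> count_list (A @ B) i \<le> k"
proof
  have full: "count_list q i = count_list xs i" if "sorted xs" "prefix q xs" "j \<in> set q" for q xs
  proof -
    obtain r where "xs = q @ r" using \<open>prefix q xs\<close> by (auto elim: prefixE)
    moreover from this have "i \<notin> set r" using that assms(3) by (fastforce simp: sorted_append)
    ultimately show ?thesis by (simp add: count_notin)
  qed
  assume "(i, k, j, l) \<in> inversions (A @ B)"
  then obtain q where q: "prefix q (A @ B)" "count_list q i \<le> k" "l < count_list q j"
    by (auto simp: inversions_def)
  then have jq: "j \<in> set q" by (metis count_notin not_less0)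
  have le: "l < count_list (A @ B) j" using q count_list_prefix_le[OF q(1), of j] by simp
  show "l < count_list A j \<and> count_list A i \<le> k \<or>
    l < count_list (A @ B) j \<and> count_list (A @ B) i \<le> k"
  proof (cases "prefix q A")
    case True
    then show ?thesis using full[OF assms(1) True jq] q count_list_prefix_le[OF True, of j] by auto
  next
    case False
    then obtain us where us: "q = A @ us" "prefix us B" using q(1) by (auto simp: prefix_append)
    show ?thesis
    proof (cases "j \<in> set us")
      case True
      then show ?thesis using full[OF assms(2) us(2)] q us le by auto
    next
      case False
      then show ?thesis using q us by (auto simp: count_notin)
    qed
  qed
next
  assume "l < count_list A j \<and> count_list A i \<le> k \<or>
    l < count_list (A @ B) j \<and> count_list (A @ B) i \<le> k"
  then show "(i, k, j, l) \<in> inversions (A @ B)"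
    using assms(3) unfolding inversions_def by (auto intro: exI[of _ A] exI[of _ "A @ B"])
qed

text \<open>
  Inside a weakly decreasing block, all occurrences of \<open>j\<close> come before all those of \<open>i\<close>, so only a
  pair with \<open>i\<close> in \<open>A\<close> and \<open>j\<close> in \<open>B\<close> fails to be inverted.
\<close>
lemma inversions_decreasing:
  assumes "sorted_wrt (\<ge>) A" "sorted_wrt (\<ge>) B" "i < j"
  shows "(i, k, j, l) \<in> inversions (A @ B) \<longleftrightarrow>
    l < count_list (A @ B) j \<and> (l < count_list A j \<or> count_list A i \<le> k)"
proof
  assume "(i, k, j, l) \<in> inversions (A @ B)"
  then obtain q where q: "prefix q (A @ B)" "count_list q i \<le> k" "l < count_list q j"
    by (auto simp: inversions_def)
  moreover have "l < count_list A j" if "prefix q A"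
    using q count_list_prefix_le[OF that, of j] by simp
  ultimately show "l < count_list (A @ B) j \<and> (l < count_list A j \<or> count_list A i \<le> k)"
    using count_list_prefix_le[OF q(1), of j] by (auto simp: prefix_append)
next
  have front: "\<exists>q. prefix q xs \<and> count_list q i = 0 \<and> count_list q j = count_list xs j"
    if "sorted_wrt (\<ge>) xs" for xs
    using that
  proof (induction xs)
    case (Cons x xs)
    show ?case
    proof (cases "x > i")
      case True
      then obtain q where "prefix q xs" "count_list q i = 0" "count_list q j = count_list xs j"
        using Cons by auto
      then show ?thesis using True by (intro exI[of _ "x # q"]) auto
    next
      case False
      then have "j \<notin> set (x # xs)" using Cons.prems assms(3) by auto
      then show ?thesis by (intro exI[of _ "[]"]) (metis Nil_prefix count_list.simps(1) count_notin)
    qed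
  qed simp
  assume *: "l < count_list (A @ B) j \<and> (l < count_list A j \<or> count_list A i \<le> k)"
  show "(i, k, j, l) \<in> inversions (A @ B)"
  proof (cases "l < count_list A j")
    case True
    obtain q where "prefix q A" "count_list q i = 0" "count_list q j = count_list A j"
      using front[OF assms(1)] by blast
    then show ?thesis using True assms(3)
      by (auto simp: inversions_def prefix_append intro!: exI[of _ q])
  next
    case False
    obtain q where "prefix q B" "count_list q i = 0" "count_list q j = count_list B j"
      using front[OF assms(2)] by blast
    then show ?thesis using False * assms(3)
      by (auto simp: inversions_def intro!: exI[of _ "A @ q"])
  qed
qed

lemma single_descent_inversions:
  assumes "single_descent p b a s" "i < j"
  shows "(i, k, j, l) \<in> inversions (p @ [b, a] @ s) \<longleftrightarrow>
    l < count_list (p @ [b]) j \<and> count_list (p @ [b]) i \<le> k \<or>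
    l < count_list (p @ [b, a] @ s) j \<and> count_list (p @ [b, a] @ s) i \<le> k"
  using inversions_increasing[of "p @ [b]" "a # s" i j k l] assms
  unfolding single_descent_def by simp

lemma single_ascent_inversions:
  assumes "single_ascent p c d s" "i < j"
  shows "(i, k, j, l) \<in> inversions (p @ [c, d] @ s) \<longleftrightarrow>
    l < count_list (p @ [c, d] @ s) j \<and>
    (l < count_list (p @ [c]) j \<or> count_list (p @ [c]) i \<le> k)"
  using inversions_decreasing[of "p @ [c]" "d # s" i j k l] assms
  unfolding single_ascent_def by simp

lemma single_descent_counts:
  assumes "single_descent p b a s"
  shows "e < a \<Longrightarrow> count_list (p @ [b]) e = count_list (p @ [b, a] @ s) e"
    and "b < e \<Longrightarrow> count_list (p @ [b]) e = 0"
proof -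
  have "e \<notin> set (a # s)" if "e < a" using assms that by (auto simp: single_descent_def)
  then show "count_list (p @ [b]) e = count_list (p @ [b, a] @ s) e" if "e < a"
    using that by (simp add: count_notin)
  have "e \<notin> set (p @ [b])" if "b < e" using assms that by (auto simp: single_descent_def sorted_append)
  then show "count_list (p @ [b]) e = 0" if "b < e" using that by (metis count_notin)
qed

lemma single_ascent_counts:
  assumes "single_ascent p c d s"
  shows "e < c \<Longrightarrow> count_list (p @ [c]) e = 0"
    and "d < e \<Longrightarrow> count_list (p @ [c]) e = count_list (p @ [c, d] @ s) e"
proof -
  have "e \<notin> set (d # s)" if "d < e" using assms that by (auto simp: single_ascent_def)
  then show "count_list (p @ [c]) e = count_list (p @ [c, d] @ s) e" if "d < e"
    using that by (simp add: count_notin)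
  have "e \<notin> set (p @ [c])" if "e < c"
    using assms that by (auto simp: single_ascent_def sorted_wrt_append)
  then show "count_list (p @ [c]) e = 0" if "e < c" using that by (metis count_notin)
qed

section \<open>The join dependency relation\<close>

text \<open>
  If the descent word inverts the two letters of the ascent, the letter \<open>d\<close> lies before its descent,
  where all letters are at most \<open>b\<close>, and \<open>c\<close> lies after it, where all letters are at least \<open>a\<close>.
\<close>
lemma ascent_inside_descent:
  assumes j: "single_descent p b a s" and m: "single_ascent p1 c d s1"
    and counts: "\<And>e. count_list (p @ [b, a] @ s) e = count_list (p1 @ [c, d] @ s1) e"
    and inv: "(c, count_list p1 c, d, count_list p1 d) \<in> inversions (p @ [b, a] @ s)"
  shows "a \<le> c \<and> d \<le> b"
proof -
  have "c < d" using m by (simp add: single_ascent_def)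
  have "count_list p1 c < count_list (p1 @ [c, d] @ s1) c" by simp
  then have *: "count_list p1 d < count_list (p @ [b]) d" "count_list (p @ [b]) c \<le> count_list p1 c"
    using inv unfolding single_descent_inversions[OF j \<open>c < d\<close>] counts by linarith+
  then have "\<not> b < d" "\<not> c < a"
    using single_descent_counts[OF j, of d] single_descent_counts[OF j, of c]
      counts[of c] \<open>count_list p1 c < _\<close> by linarith+
  then show ?thesis by simp
qed

text \<open>
  If the ascent word does not invert the two letters of the descent, the letter \<open>a\<close> lies before its
  ascent, where all letters are at least \<open>c\<close>, and \<open>b\<close> lies after it, where all letters are at
  most \<open>d\<close>.
\<close>
lemma descent_inside_ascent:
  assumes j: "single_descent p b a s" and m: "single_ascent p1 c d s1"
    and counts: "\<And>e. count_list (p @ [b, a] @ s) e = count_list (p1 @ [c, d] @ s1) e"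
    and inv: "(a, count_list p a, b, count_list p b) \<notin> inversions (p1 @ [c, d] @ s1)"
  shows "c \<le> a \<and> b \<le> d"
proof -
  have "a < b" using j by (simp add: single_descent_def)
  have less: "count_list p b < count_list (p1 @ [c, d] @ s1) b"
    unfolding counts[symmetric] by simp
  then have "count_list (p1 @ [c]) b \<le> count_list p b" "count_list p a < count_list (p1 @ [c]) a"
    using inv unfolding single_ascent_inversions[OF m \<open>a < b\<close>] by linarith+
  then have "\<not> a < c" "\<not> d < b"
    using single_ascent_counts[OF m, of a] single_ascent_counts[OF m, of b] less by linarith+
  then show ?thesis by simp
qed

text \<open>
  The hypotheses say that the word with the descent is below the upper cover of the word with the
  ascent, but not below the latter. When descent and ascent involve the same letters \<open>c < d\<close>, this
  fixes how many occurrences of each letter precede the descent. The pair at the descent is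
  inverted by the upper cover only, so it must be the pair at the ascent. For a letter strictly
  between \<open>c\<close> and \<open>d\<close>, the inversions with this \<open>c\<close> bound the number from above and those with this
  \<open>d\<close> bound it from below.
\<close>
lemma descent_determined_by_ascent:
  assumes j: "single_descent p d c s" and m: "single_ascent p1 c d s1"
    and counts: "\<And>e. count_list (p @ [d, c] @ s) e = count_list (p1 @ [c, d] @ s1) e"
    and inv: "(c, count_list p1 c, d, count_list p1 d) \<in> inversions (p @ [d, c] @ s)"
    and below: "inversions (p @ [d, c] @ s) \<subseteq>
      insert (c, count_list p1 c, d, count_list p1 d) (inversions (p1 @ [c, d] @ s1))"
  shows "count_list (p @ [d]) e =
    (if e < c then count_list (p1 @ [c, d] @ s1) e else if d < e then 0
     else if e = d then Suc (count_list p1 d) else count_list p1 e)"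
proof -
  have cd: "c < d" using m by (simp add: single_ascent_def)
  let ?A = "count_list (p @ [d])" and ?M = "count_list (p1 @ [c])"
    and ?V = "count_list (p1 @ [c, d] @ s1)"
  note invj = single_descent_inversions[OF j, unfolded counts]
  note invm = single_ascent_inversions[OF m]
  have M: "?M c = Suc (count_list p1 c)" "?M d = count_list p1 d" "\<And>e. e \<noteq> c \<Longrightarrow> ?M e = count_list p1 e"
    "?M c \<le> ?V c" "?M d < ?V d" "?A d = Suc (count_list p d)" "?A c = count_list p c"
    using cd by auto
  have A: "?A e \<le> ?V e" for e unfolding counts[symmetric] by simp
  have Ac: "?A c < ?V c" using cd unfolding counts[symmetric] by simp
  have *: "?M d < ?A d" "?A c < ?M c"
    using inv M unfolding invj[OF cd] by auto
  \<comment> \<open>The pair at the descent, which the ascent word leaves uninverted by the inequalities just shown.\<close>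
  have "(c, ?A c, d, count_list p d) \<in> inversions (p @ [d, c] @ s)"
    unfolding invj[OF cd] using M by simp
  then have "(c, ?A c, d, count_list p d) = (c, count_list p1 c, d, count_list p1 d)"
    using below * M unfolding invm[OF cd] by (auto simp: invm[OF cd, simplified])
  then have ends: "?A c = count_list p1 c" "?A d = Suc (count_list p1 d)" using M by auto
  have middle: "?A e = ?M e" if e: "c < e" "e < d" for e
  proof (rule antisym)
    have "(c, ?A c, e, l) \<in> inversions (p1 @ [c, d] @ s1)" if "l < ?A e" for l
    proof -
      have "(c, ?A c, e, l) \<in> inversions (p @ [d, c] @ s)"
        unfolding invj[OF e(1)] using that by simp
      then show ?thesis using below e by blast
    qed
    then have "l < ?M e" if "l < ?A e" for l
      using that * unfolding invm[OF e(1)] by (meson not_le)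
    then show "?A e \<le> ?M e" by (meson not_le less_irrefl)
    have "(e, ?A e, d, count_list p1 d) \<in> inversions (p @ [d, c] @ s)"
      unfolding invj[OF e(2)] using ends by simp
    then have "(e, ?A e, d, count_list p1 d) \<in> inversions (p1 @ [c, d] @ s1)"
      using below e by blast
    then show "?M e \<le> ?A e" using M unfolding invm[OF e(2)] by simp
  qed
  show ?thesis
  proof (cases "c < e \<and> e < d")
    case True
    then show ?thesis using middle[of e] M(3)[of e] by simp
  next
    case False
    then show ?thesis
      using ends single_descent_counts[OF j, of e] counts[of e] by (auto simp del: count_list_append)
  qed
qed

lemma single_descent_eq_if_counts:
  assumes "single_descent p b a s" "single_descent p' b a s'"
    and "\<And>e. count_list (p @ [b]) e = count_list (p' @ [b]) e"
    and "\<And>e. count_list (p @ [b, a] @ s) e = count_list (p' @ [b, a] @ s') e"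
  shows "p @ [b, a] @ s = p' @ [b, a] @ s'"
proof -
  have eq: "xs = ys" if "sorted xs" "sorted ys" "\<And>e. count_list xs e = count_list ys e" for xs ys :: "nat list"
  proof -
    have "mset xs = mset ys" using that(3) by (intro multiset_eqI) (simp add: count_mset)
    then show ?thesis using that by (metis properties_for_sort)
  qed
  have "p @ [b] = p' @ [b]"
    using assms(1-3) unfolding single_descent_def by (intro eq) auto
  moreover have "count_list (a # s) e = count_list (a # s') e" for e
    using assms(4)[of e] \<open>p @ [b] = p' @ [b]\<close> by (cases "b = e") simp_all
  then have "a # s = a # s'"
    using assms(1,2) unfolding single_descent_def by (intro eq) auto
  ultimately show ?thesis by simp
qed

text \<open>
  The intervals of the two descents are nested with that of the ascent of \<open>m\<close> in between. They
  cannot be equal: the inversion \<open>?\<nu>\<close> that the upper cover of \<open>m\<close> adds would then also be the one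
  that \<open>j'\<close> adds to its lower cover, so both words would be the one determined by \<open>m\<close>.
\<close>
lemma join_dependency_shrinks:
  assumes D: "join_dependency (multinomial_lattice n v) (p @ [b, a] @ s) j'"
    and j: "single_descent p b a s"
  obtains p' b' a' s' where "single_descent p' b' a' s'" "j' = p' @ [b', a'] @ s'" "b' - a' < b - a"
proof -
  let ?L = "multinomial_lattice n v" and ?j = "p @ [b, a] @ s"
  from D obtain m where irr: "join_irreducible ?L ?j" "join_irreducible ?L j'" "meet_irreducible ?L m"
    and ne: "?j \<noteq> j'" and m: "(?j, m) \<notin> ?L" "(?j, upper_cover ?L m) \<in> ?L"
    "(j', m) \<notin> ?L" "(lower_cover ?L j', m) \<in> ?L"
    by (auto simp: join_dependency_def)
  obtain p' b' a' s' where j': "single_descent p' b' a' s'" "j' = p' @ [b', a'] @ s'"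
    using irr(2) by (rule join_irreducible_single_descent)
  obtain p1 c d s1 where m': "single_ascent p1 c d s1" "m = p1 @ [c, d] @ s1"
    using irr(3) by (rule meet_irreducible_single_ascent)
  have words: "?j \<in> multinomial_words n v" "j' \<in> multinomial_words n v" "m \<in> multinomial_words n v"
    using irr by (simp_all only: join_irreducible_def meet_irreducible_def Field_multinomial_lattice)
  then have words': "p' @ [a', b'] @ s' \<in> multinomial_words n v" "p1 @ [d, c] @ s1 \<in> multinomial_words n v"
    using j'(2) m'(2) swap_in_multinomial_words by blast+
  have ab: "a < b" "a' < b'" "c < d"
    using j j' m' by (simp_all add: single_descent_def single_ascent_def)
  have counts: "count_list ?j e = count_list (p1 @ [c, d] @ s1) e"
    "count_list (p' @ [b', a'] @ s') e = count_list (p1 @ [c, d] @ s1) e" for e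
    using multinomial_words_count_eq words unfolding j' m' by blast+
  let ?\<nu> = "(c, count_list p1 c, d, count_list p1 d)"
  let ?\<delta> = "(a', count_list p' a', b', count_list p' b')"
  have "upper_cover ?L m = p1 @ [d, c] @ s1" "lower_cover ?L j' = p' @ [a', b'] @ s'"
    using single_ascent_meet_irreducible(2)[OF m'(1)] single_descent_join_irreducible(2)[OF j'(1)]
      words unfolding j' m' by blast+
  then have incl: "\<not> inversions ?j \<subseteq> inversions m" "inversions ?j \<subseteq> inversions (p1 @ [d, c] @ s1)"
    "\<not> inversions j' \<subseteq> inversions m" "inversions (p' @ [a', b'] @ s') \<subseteq> inversions m"
    using m words words' by (simp_all only: multinomial_lattice_iff) auto
  have \<nu>: "?\<nu> \<in> inversions ?j" "inversions ?j \<subseteq> insert ?\<nu> (inversions m)"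
    using incl(1,2) unfolding inversions_swap[OF ab(3)] m' by blast+
  have \<delta>: "?\<delta> \<notin> inversions m" "inversions j' \<subseteq> insert ?\<delta> (inversions m)"
    using incl(3,4) unfolding inversions_swap[OF ab(2)] j' by blast+
  have 1: "a \<le> c \<and> d \<le> b"
    using ascent_inside_descent[OF j m'(1) counts(1) \<nu>(1)] .
  have 2: "c \<le> a' \<and> b' \<le> d"
    using descent_inside_ascent[OF j'(1) m'(1) counts(2)] \<delta>(1) unfolding m' by blast
  have "b' - a' < b - a"
  proof (rule ccontr)
    assume "\<not> b' - a' < b - a"
    then have eqs: "a = c" "a' = c" "b = d" "b' = d" using 1 2 ab by linarith+
    have less: "count_list p' d < count_list (p1 @ [c, d] @ s1) d"
      unfolding counts(2)[symmetric] eqs by simp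
    have "count_list (p1 @ [c]) d \<le> count_list p' d" "count_list p' c < count_list (p1 @ [c]) c"
      using \<delta>(1) less unfolding m' eqs single_ascent_inversions[OF m'(1) ab(3)] by linarith+
    then have "?\<nu> \<in> inversions j'"
      using j'(1) ab(3) unfolding j'(2) eqs by (subst single_descent_inversions) auto
    moreover have "?\<nu> \<notin> inversions m"
      using swapped_pair_not_inverted[OF ab(3)] unfolding m' by blast
    ultimately have \<nu>': "?\<nu> \<in> inversions j'" and "?\<nu> = ?\<delta>"
      using \<delta>(2) by blast+
    then have \<nu>'': "inversions j' \<subseteq> insert ?\<nu> (inversions m)"
      using \<delta>(2) by (simp only:)
    note u = descent_determined_by_ascent[OF j[unfolded eqs] m'(1) counts(1)[unfolded eqs]
        \<nu>(1)[unfolded eqs] \<nu>(2)[unfolded eqs m']]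
    note u' = descent_determined_by_ascent[OF j'(1)[unfolded eqs] m'(1) counts(2)[unfolded eqs]
        \<nu>'[unfolded j' eqs] \<nu>''[unfolded j' m' eqs]]
    have "p @ [d, c] @ s = p' @ [d, c] @ s'"
    proof (rule single_descent_eq_if_counts)
      show "single_descent p d c s" "single_descent p' d c s'"
        using j j'(1) unfolding eqs by blast+
      show "count_list (p @ [d]) e = count_list (p' @ [d]) e" for e
        unfolding u u' by (rule refl)
      show "count_list (p @ [d, c] @ s) e = count_list (p' @ [d, c] @ s') e" for e
        using counts[of e] unfolding eqs by (simp only:)
    qed
    then show False using ne by (simp add: j' eqs)
  qed
  then show thesis using that j' by blast
qed

lemma D_path_length_bound:
  assumes "D_path (multinomial_lattice n v) (j # js)" "single_descent p b a s" "j = p @ [b, a] @ s"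
  shows "length js < b - a"
  using assms
proof (induction js arbitrary: j p b a s)
  case Nil
  then show ?case by (simp add: single_descent_def)
next
  case (Cons j' js)
  then have "join_dependency (multinomial_lattice n v) (p @ [b, a] @ s) j'"
    "D_path (multinomial_lattice n v) (j' # js)"
    by (auto simp: D_path_def)
  with Cons.prems(2) obtain p' b' a' s' where "single_descent p' b' a' s'" "j' = p' @ [b', a'] @ s'"
    "b' - a' < b - a"
    using join_dependency_shrinks by blast
  then show ?case using Cons.IH[of j'] \<open>D_path _ (j' # js)\<close> by fastforce
qed

section \<open>A longest path\<close>

definition sorted_word :: "nat \<Rightarrow> (nat \<Rightarrow> nat) \<Rightarrow> nat list" where
  "sorted_word n f = concat (map (\<lambda>e. replicate (f e) e) [1..<Suc n])"

lemma count_list_sorted_word: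
  "count_list (sorted_word n f) e = (if e \<in> {1..n} then f e else 0)"
proof -
  have "count_list (replicate k x) e = (if x = e then k else 0)" for k and x :: nat
    by (induction k) auto
  then show ?thesis by (induction n) (auto simp: sorted_word_def)
qed

lemma set_sorted_word: "set (sorted_word n f) = {e \<in> {1..n}. f e > 0}"
  by (auto simp: sorted_word_def set_replicate_conv_if split: if_splits)

lemma sorted_sorted_word: "sorted (sorted_word n f)"
proof (induction n)
  case (Suc n)
  have "sorted_word (Suc n) f = sorted_word n f @ replicate (f (Suc n)) (Suc n)"
    by (simp add: sorted_word_def)
  then show ?case using Suc by (auto simp: sorted_append set_sorted_word)
qed (simp add: sorted_word_def)

text \<open>
  In exponential notation, this is the word
  \<open>1^(v 1 - 1) 2^(v 2) \<dots> b^(v b) 1 (b+1)^(v (b+1)) \<dots> n^(v n)\<close>. One \<open>b\<close> and one \<open>1\<close> are split off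
  to display the descent.
\<close>
definition path_word :: "nat \<Rightarrow> (nat \<Rightarrow> nat) \<Rightarrow> nat \<Rightarrow> nat list" where
  "path_word n v b =
     sorted_word n (\<lambda>e. if e = 1 \<or> e = b then v e - 1 else if e < b then v e else 0) @ [b, 1] @
     sorted_word n (\<lambda>e. if b < e then v e else 0)"

lemma path_word_single_descent:
  assumes "2 \<le> b"
  shows "single_descent
    (sorted_word n (\<lambda>e. if e = 1 \<or> e = b then v e - 1 else if e < b then v e else 0)) b 1
    (sorted_word n (\<lambda>e. if b < e then v e else 0))"
  using assms by (auto simp: single_descent_def sorted_append sorted_sorted_word set_sorted_word
      split: if_splits)

lemma path_word_in_multinomial_words:
  assumes "2 \<le> b" "b \<le> n" "\<forall>i\<in>{1..n}. v i > 0"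
  shows "path_word n v b \<in> multinomial_words n v"
  using assms
  by (auto simp: multinomial_words_def path_word_def set_sorted_word count_list_sorted_word)

text \<open>
  Up to nonexistent occurrences, the only inverted pairs consist of the last \<open>1\<close> and an arbitrary
  occurrence of one of the letters \<open>2, \<dots>, b\<close>.
\<close>
lemma path_word_inversions:
  assumes "2 \<le> b" "b \<le> n" "\<forall>i\<in>{1..n}. v i > 0" "i < j"
  shows "(i, k, j, l) \<in> inversions (path_word n v b) \<longleftrightarrow>
    (j \<in> {2..b} \<and> l < v j \<and>
      (if i = 1 then v 1 - 1 \<le> k else i \<in> {1..n} \<longrightarrow> v i \<le> k)) \<or>
    (j \<in> {1..n} \<and> l < v j \<and> (i \<in> {1..n} \<longrightarrow> v i \<le> k))"
proof -
  have c: "count_list (path_word n v b) e = (if e \<in> {1..n} then v e else 0)" for e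
    using path_word_in_multinomial_words[OF assms(1-3)]
    by (cases "e \<in> {1..n}") (auto simp: multinomial_words_def intro: count_notin)
  show ?thesis
    unfolding single_descent_inversions[OF path_word_single_descent[OF assms(1)] assms(4),
      folded path_word_def] c
    using assms by (auto simp: count_list_sorted_word)
qed

text \<open>
  The witness is the weakly decreasing word with the last \<open>b\<close> moved to the end, just behind
  the last \<open>1\<close>. Its only uninverted pairs are those of the last \<open>b\<close> with smaller letters. Among
  these, both path words invert only \<open>?\<nu>\<close>, the pair of the last \<open>1\<close> and the last \<open>b\<close>; it is the
  inversion that the upper cover of the witness adds, and also the one that the smaller path word
  adds to its lower cover.
\<close>
lemma path_word_join_dependency:
  assumes b: "2 \<le> b" "b < n" and v: "\<forall>i\<in>{1..n}. v i > 0"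
  shows "join_dependency (multinomial_lattice n v) (path_word n v (Suc b)) (path_word n v b)"
proof -
  let ?L = "multinomial_lattice n v"
  let ?p = "rev (sorted_word n (\<lambda>e. if e = 1 \<or> e = b then v e - 1 else v e))"
  let ?m = "?p @ [1, b] @ []"
  let ?\<nu> = "(1, v 1 - 1, b, v b - 1)"
  have vpos: "v 1 > 0" "v b > 0" using b v by auto
  have m: "single_ascent ?p 1 b []"
    using b by (auto simp: single_ascent_def sorted_wrt_append sorted_wrt_rev sorted_sorted_word
        set_sorted_word)
  have mw: "?m \<in> multinomial_words n v"
    using b vpos by (auto simp: multinomial_words_def set_sorted_word count_list_sorted_word)
  have mw': "?p @ [b, 1] @ [] \<in> multinomial_words n v"
    using mw swap_in_multinomial_words by blast
  have mc: "count_list ?m e = (if e \<in> {1..n} then v e else 0)" for e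
    using mw by (cases "e \<in> {1..n}") (auto simp: multinomial_words_def intro: count_notin)
  have \<nu>: "(1, count_list ?p 1, b, count_list ?p b) = ?\<nu>"
    using b by (simp add: count_list_sorted_word)
  have \<nu>m: "?\<nu> \<notin> inversions ?m"
    using swapped_pair_not_inverted[of 1 b ?p "[]"] b unfolding \<nu> by simp
  have upper: "inversions (?p @ [b, 1] @ []) = insert ?\<nu> (inversions ?m)"
    using inversions_swap[of 1 b ?p "[]"] b unfolding \<nu> by simp
  have below: "inversions (path_word n v b') \<subseteq> insert ?\<nu> (inversions ?m)"
    and \<nu>b: "?\<nu> \<in> inversions (path_word n v b')" if b': "b' = b \<or> b' = Suc b" for b'
  proof -
    have b'n: "2 \<le> b'" "b' \<le> n" using b b' by auto
    show "?\<nu> \<in> inversions (path_word n v b')"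
      using b b' v by (subst path_word_inversions[OF b'n v]) auto
    show "inversions (path_word n v b') \<subseteq> insert ?\<nu> (inversions ?m)"
    proof (rule subsetI, rule insertCI, unfold split_paired_all)
      fix i k j l
      assume 1: "(i, k, j, l) \<in> inversions (path_word n v b')"
        and 2: "(i, k, j, l) \<notin> inversions ?m"
      have ij: "i < j" using 1 by (simp add: inversions_def)
      show "(i, k, j, l) = ?\<nu>"
        using 1 2 b b' b'n unfolding path_word_inversions[OF b'n v ij] single_ascent_inversions[OF m ij] mc
        by (auto simp: count_list_sorted_word split: if_splits)
    qed
  qed
  let ?f = "sorted_word n (\<lambda>e. if e = 1 \<or> e = b then v e - 1 else if e < b then v e else 0)"
  let ?g = "sorted_word n (\<lambda>e. if b < e then v e else 0)"
  have w: "path_word n v b \<in> multinomial_words n v" "path_word n v (Suc b) \<in> multinomial_words n v"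
    using path_word_in_multinomial_words b v by auto
  have w': "?f @ [1, b] @ ?g \<in> multinomial_words n v"
    using w(1) swap_in_multinomial_words unfolding path_word_def by blast
  have \<delta>: "(1, count_list ?f 1, b, count_list ?f b) = ?\<nu>"
    using b by (simp add: count_list_sorted_word)
  have "?\<nu> \<notin> inversions (?f @ [1, b] @ ?g)"
    using swapped_pair_not_inverted[of 1 b ?f ?g] b unfolding \<delta> by simp
  moreover have "inversions (?f @ [1, b] @ ?g) \<subseteq> inversions (path_word n v b)"
    using inversions_swap_mono[of 1 b ?f ?g] b unfolding path_word_def by simp
  ultimately have lower: "inversions (?f @ [1, b] @ ?g) \<subseteq> inversions ?m"
    using below[of b] by blast
  have ne: "path_word n v (Suc b) \<noteq> path_word n v b"
    using single_descent_unique[OF path_word_single_descent[of "Suc b" n v], of 1 b] b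
    unfolding path_word_def by auto
  note jd = single_descent_join_irreducible[OF path_word_single_descent, folded path_word_def]
  note mi = single_ascent_meet_irreducible[OF m mw]
  have jdl: "lower_cover ?L (path_word n v b) = ?f @ [1, b] @ ?g"
    using jd(2)[OF b(1) w(1)] .
  show ?thesis
    unfolding join_dependency_def
  proof (intro conjI exI[of _ ?m])
    show "join_irreducible ?L (path_word n v (Suc b))" using jd(1)[OF _ w(2)] b by simp
    show "join_irreducible ?L (path_word n v b)" using jd(1)[OF b(1) w(1)] .
    show "path_word n v (Suc b) \<noteq> path_word n v b" by (rule ne)
    show "meet_irreducible ?L ?m" by (rule mi)
    show "(path_word n v (Suc b), ?m) \<notin> ?L"
      unfolding multinomial_lattice_iff[OF w(2) mw] using \<nu>b[of "Suc b"] \<nu>m by blast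
    show "(path_word n v b, ?m) \<notin> ?L"
      unfolding multinomial_lattice_iff[OF w(1) mw] using \<nu>b[of b] \<nu>m by blast
    show "(path_word n v (Suc b), upper_cover ?L ?m) \<in> ?L"
      unfolding mi(2) multinomial_lattice_iff[OF w(2) mw'] upper using below[of "Suc b"] by blast
    show "(lower_cover ?L (path_word n v b), ?m) \<in> ?L"
      unfolding jdl multinomial_lattice_iff[OF w' mw] by (rule lower)
  qed
qed

lemma D_path_path_words:
  assumes "\<forall>i\<in>{1..n}. v i > 0" "k \<le> n"
  shows "D_path (multinomial_lattice n v) (map (path_word n v) (rev [2..<Suc k]))"
  using assms(2)
proof (induction k)
  case (Suc k)
  let ?L = "multinomial_lattice n v"
  show ?case
  proof (cases "1 \<le> k")
    case True
    then have "join_irreducible ?L (path_word n v (Suc k))"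
      using single_descent_join_irreducible(1)[OF path_word_single_descent, folded path_word_def]
        path_word_in_multinomial_words[of "Suc k"] Suc.prems assms(1) by simp
    moreover have "join_dependency ?L (path_word n v (Suc k)) (path_word n v k)" if "2 \<le> k"
      using path_word_join_dependency[of k n v] that Suc.prems assms(1) by simp
    ultimately show ?thesis
      using Suc True by (cases "k = 1") (auto simp: D_path_def successively_Cons hd_map hd_rev)
  qed (auto simp: D_path_def)
qed (simp add: D_path_def)

theorem corollary3p14:
  fixes n :: nat and v :: "nat \<Rightarrow> nat"
  assumes "n \<ge> 1"
  shows "(\<forall>js. D_path (multinomial_lattice n v) js \<longrightarrow> D_path_length js \<le> int n - 2) \<and>
    ((\<forall>i\<in>{1..n}. v i > 0) \<longrightarrow>
      (\<exists>js. D_path (multinomial_lattice n v) js \<and> D_path_length js = int n - 2))"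
proof (intro conjI allI impI)
  fix js
  assume path: "D_path (multinomial_lattice n v) js"
  show "D_path_length js \<le> int n - 2"
  proof (cases js)
    case Nil
    then show ?thesis using assms by (simp add: D_path_length_def)
  next
    case (Cons j js')
    then have irr: "join_irreducible (multinomial_lattice n v) j"
      using path by (simp add: D_path_def)
    then obtain p b a s where d: "single_descent p b a s" "j = p @ [b, a] @ s"
      by (rule join_irreducible_single_descent)
    have "length js' < b - a"
      using D_path_length_bound d path Cons by blast
    moreover have "1 \<le> a" "b \<le> n"
      using irr d by (auto simp: join_irreducible_def Field_multinomial_lattice multinomial_words_def)
    ultimately show ?thesis using Cons by (simp add: D_path_length_def)
  qed
next
  assume "\<forall>i\<in>{1..n}. v i > 0"
  then have "D_path (multinomial_lattice n v) (map (path_word n v) (rev [2..<Suc n]))"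
    by (rule D_path_path_words) simp
  moreover have "D_path_length (map (path_word n v) (rev [2..<Suc n])) = int n - 2"
    using assms by (simp add: D_path_length_def)
  ultimately show "\<exists>js. D_path (multinomial_lattice n v) js \<and> D_path_length js = int n - 2"
    by blast
qed

end
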